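(* Let $N$ be a positive integer and for each integer $n\ge 0$ let $$a_n^N=\sum_{\substack{p_1+\cdots+p_N=n\\ p_i\in\mathbb{Z}_{\ge 0}}}\left(\frac{n!}{p_1!\,p_2!\cdots p_N!}\right)^2 .$$ For each integer $k\ge 0$ let $S_k(N)$ be the set of sequences $(\alpha_1,\dots,\alpha_k)$ of positive integers with $\alpha_1\le N$ and $\alpha_{i+1}\le \alpha_i-2$ for $1\le i<k$ (so $S_0(N)$ consists only of the empty sequence), and put $\beta_i=N+1-\alpha_i$. Define $$c_k(n)=n^{N+1}\sum_{(\alpha_1,\dots,\alpha_k)\in S_k(N)}\ \prod_{i=1}^k\left(-\alpha_i\beta_i\left(\frac{n-i}{n-i+1}\right)^{\alpha_i-1}\right),$$ where an empty product equals $1$ (and $c_k(n)=0$ when $S_k(N)$ is empty, which is the case for $k>\lfloor (N+1)/2\rfloor$). Then for every integer $n\ge \max(1,\lfloor (N+1)/2\rfloor)$, $$\sum_{k=0}^{\lfloor (N+1)/2\rfloor} c_k(n)\,a_{n-k}^N=0 .$$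
   Context: The coefficients $c_k(n)$ are polynomials in $n$. For $N=2$ this gives $n^3a_n^2-2n^2(2n-1)a_{n-1}^2=0$, and for $N=3$ it gives $n^4a^3_n-n^2(10n^2-10n+3)a^3_{n-1}+9n^2(n-1)^2a^3_{n-2}=0$. *)

theory Defs
  imports Complex_Main "HOL-Library.FuncSet"
begin

text \<open>
  The real number \<open>a_seq N n\<close> is the quantity usually written \<open>a\<^sub>n\<close> with superscript \<open>N\<close>.
  Tuples indexed by \<open>1, \<dots>, m\<close> are extensional functions on \<open>{1..m}\<close>, so that each tuple is
  represented exactly once; in particular there is exactly one empty tuple.
\<close>

definition weak_compositions :: "nat \<Rightarrow> nat \<Rightarrow> (nat \<Rightarrow> nat) set" where
  "weak_compositions N n = {p \<in> {1..N} \<rightarrow>\<^sub>E UNIV. (\<Sum>i=1..N. p i) = n}"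

definition a_seq :: "nat \<Rightarrow> nat \<Rightarrow> real" where
  "a_seq N n = (\<Sum>p\<in>weak_compositions N n. (fact n / (\<Prod>i=1..N. fact (p i)))\<^sup>2)"

text \<open>
  The gap condition \<open>\<alpha> (i + 1) \<le> \<alpha> i - 2\<close> is an inequality between integers; it is stated
  additively because subtraction on \<^typ>\<open>nat\<close> truncates.
\<close>

definition alpha_seqs :: "nat \<Rightarrow> nat \<Rightarrow> (nat \<Rightarrow> nat) set" where
  "alpha_seqs k N = {\<alpha> \<in> {1..k} \<rightarrow>\<^sub>E {1..}.
     (1 \<le> k \<longrightarrow> \<alpha> 1 \<le> N) \<and> (\<forall>i. 1 \<le> i \<and> i < k \<longrightarrow> \<alpha> (i + 1) + 2 \<le> \<alpha> i)}"

text \<open>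
  The exponent \<open>\<alpha> i - 1\<close> does not truncate, as \<open>\<alpha> i \<ge> 1\<close> on \<^term>\<open>alpha_seqs k N\<close>. For \<open>k \<le> n\<close> all
  denominators are positive; a factor with \<open>\<alpha> i = 1\<close> and \<open>i = n\<close> contains \<open>0 ^ 0 = 1\<close>, in
  agreement with evaluating \<open>c\<^sub>k\<close> as a polynomial in \<open>n\<close>.
\<close>

definition c_coeff :: "nat \<Rightarrow> nat \<Rightarrow> nat \<Rightarrow> real" where
  "c_coeff N k n = real n ^ (N + 1) *
     (\<Sum>\<alpha>\<in>alpha_seqs k N. \<Prod>i=1..k.
        - (real (\<alpha> i) * (real N + 1 - real (\<alpha> i)) *
           ((real n - real i) / (real n - real i + 1)) ^ (\<alpha> i - 1)))"

text \<open>Both sums range over finite sets, so neither takes the default value 0.\<close>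

lemma finite_weak_compositions: "finite (weak_compositions N n)"
proof (rule finite_subset)
  show "weak_compositions N n \<subseteq> {1..N} \<rightarrow>\<^sub>E {..n}"
  proof
    fix p assume p: "p \<in> weak_compositions N n"
    have "p i \<le> n" if "i \<in> {1..N}" for i
      using p member_le_sum[of i "{1..N}" p] that by (auto simp: weak_compositions_def)
    with p show "p \<in> {1..N} \<rightarrow>\<^sub>E {..n}"
      by (auto simp: weak_compositions_def PiE_iff)
  qed
qed (auto intro: finite_PiE)

lemma finite_alpha_seqs: "finite (alpha_seqs k N)"
proof (rule finite_subset)
  show "alpha_seqs k N \<subseteq> {1..k} \<rightarrow>\<^sub>E {..N}"
  proof
    fix \<alpha> assume \<alpha>: "\<alpha> \<in> alpha_seqs k N"
    have "1 \<le> i \<Longrightarrow> i \<le> k \<Longrightarrow> \<alpha> i \<le> N" for i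
    proof (induction i rule: dec_induct)
      case base
      then show ?case using \<alpha> by (auto simp: alpha_seqs_def)
    next
      case (step j)
      then have "\<alpha> (j + 1) + 2 \<le> \<alpha> j" using \<alpha> by (simp add: alpha_seqs_def)
      with step show ?case by simp
    qed
    with \<alpha> show "\<alpha> \<in> {1..k} \<rightarrow>\<^sub>E {..N}"
      by (auto simp: alpha_seqs_def PiE_iff)
  qed
qed (auto intro: finite_PiE)

end

theory Submission
  imports Defs "HOL-Computational_Algebra.Formal_Power_Series"
begin

unbundle fps_syntax

text \<open>
  Let \<open>y = \<Sum> x\<^sup>n / n!\<^sup>2\<close> and \<open>\<theta> = x d/dx\<close>, so that \<open>\<theta>\<^sup>2 y = x y\<close> and \<open>y\<^sup>N = \<Sum> a\<^sub>n x\<^sup>n / n!\<^sup>2\<close>.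
  The series \<open>L\<^sub>m = N (N - 1) \<dots> (N - m + 1) y\<^bsup>N - m\<^esup> (\<theta> y)\<^sup>m\<close> satisfy
  \<open>L\<^sub>m\<^sub>+\<^sub>2 = \<theta> L\<^sub>m\<^sub>+\<^sub>1 - (m + 1) (N - m) x L\<^sub>m\<close> together with \<open>L\<^sub>0 = y\<^sup>N\<close> and \<open>L\<^sub>N\<^sub>+\<^sub>1 = 0\<close>. Unrolling this
  recurrence down to \<open>L\<^sub>0\<close>, a sequence \<open>\<alpha>\<close> records the steps at which the term with the factor \<open>x\<close>
  is chosen; so the coefficient of \<open>x\<^sup>n\<close> in \<open>L\<^sub>N\<^sub>+\<^sub>1\<close> is the asserted sum divided by \<open>n!\<^sup>2\<close>.
\<close>

section \<open>The Bessel series and the Euler operator\<close>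

definition bessel_fps :: "real fps" where
  "bessel_fps = Abs_fps (\<lambda>n. 1 / (fact n)\<^sup>2)"

definition theta :: "real fps \<Rightarrow> real fps" where
  "theta f = fps_X * fps_deriv f"

lemma theta_nth: "theta f $ n = real n * f $ n"
  by (cases n) (simp_all add: theta_def)

lemma theta_mult: "theta (f * g) = theta f * g + f * theta g"
  by (simp add: theta_def algebra_simps)

lemma theta_const_mult: "theta (fps_const c * f) = fps_const c * theta f"
  by (simp add: theta_def algebra_simps)

lemma theta_power: "theta (f ^ k) = of_nat k * f ^ (k - 1) * theta f"
  by (simp add: theta_def fps_deriv_power fps_of_nat algebra_simps)

lemma theta_theta_bessel: "theta (theta bessel_fps) = fps_X * bessel_fps"
proof (rule fps_ext)
  fix n
  show "theta (theta bessel_fps) $ n = (fps_X * bessel_fps) $ n"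
    by (cases n) (simp_all add: theta_nth bessel_fps_def power2_eq_square field_simps del: of_nat_Suc)
qed

section \<open>Weak compositions as coefficients of powers of the series\<close>

lemma sum_weak_compositions_Suc:
  fixes f :: "(nat \<Rightarrow> nat) \<Rightarrow> real"
  shows "(\<Sum>p\<in>weak_compositions (Suc N) n. f p) =
    (\<Sum>j=0..n. \<Sum>p\<in>weak_compositions N j. f (p(Suc N := n - j)))"
proof -
  have "(\<Sum>p\<in>weak_compositions (Suc N) n. f p) =
    (\<Sum>(j, p)\<in>(SIGMA j:{0..n}. weak_compositions N j). f (p(Suc N := n - j)))"
  proof (rule sum.reindex_bij_witness
      [where i = "\<lambda>(j, p). p(Suc N := n - j)"
         \<comment> \<open>Resetting the last entry to \<open>undefined\<close> makes the shortened
           tuple extensional on \<open>{1..N}\<close>.\<close>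
         and j = "\<lambda>p. (\<Sum>i=1..N. p i, p(Suc N := undefined))"])
    fix p assume p: "p \<in> weak_compositions (Suc N) n"
    then show "(\<Sum>i=1..N. p i, p(Suc N := undefined)) \<in> (SIGMA j:{0..n}. weak_compositions N j)"
      by (auto simp: weak_compositions_def PiE_iff extensional_def)
    from p show eq: "(case (\<Sum>i=1..N. p i, p(Suc N := undefined)) of
        (j, q) \<Rightarrow> q(Suc N := n - j)) = p"
      by (auto simp: weak_compositions_def fun_eq_iff)
    from p show "(case (\<Sum>i=1..N. p i, p(Suc N := undefined)) of
        (j, q) \<Rightarrow> f (q(Suc N := n - j))) = f p"
      using eq by simp
  next
    fix jp assume jp: "jp \<in> (SIGMA j:{0..n}. weak_compositions N j)"
    obtain j p where [simp]: "jp = (j, p)" by (cases jp)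
    from jp show "(case jp of (j, p) \<Rightarrow> p(Suc N := n - j)) \<in> weak_compositions (Suc N) n"
      by (auto simp: weak_compositions_def PiE_iff extensional_def)
    from jp show "(\<Sum>i=1..N. (case jp of (j, p) \<Rightarrow> p(Suc N := n - j)) i,
        (case jp of (j, p) \<Rightarrow> p(Suc N := n - j))(Suc N := undefined)) = jp"
      by (auto simp: weak_compositions_def PiE_iff extensional_def fun_eq_iff)
  qed
  then show ?thesis
    by (simp add: sum.Sigma finite_weak_compositions)
qed

text \<open>Induction on \<open>N\<close>: the Cauchy product with one more factor
  \<open>bessel_fps\<close> splits off the last part \<open>n - j\<close>.\<close>

lemma bessel_power_nth:
  "(bessel_fps ^ N) $ n = (\<Sum>p\<in>weak_compositions N n. (1 / (\<Prod>i=1..N. fact (p i)))\<^sup>2)"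
proof (induction N arbitrary: n)
  case 0
  have "weak_compositions 0 n = (if n = 0 then {\<lambda>_. undefined} else {})"
    by (auto simp: weak_compositions_def)
  then show ?case by simp
next
  case (Suc N)
  have "(bessel_fps ^ Suc N) $ n = (\<Sum>j=0..n. (bessel_fps ^ N) $ j * (1 / (fact (n - j))\<^sup>2))"
    by (simp add: power_Suc2 fps_mult_nth bessel_fps_def del: power_Suc)
  then show ?case
    by (simp add: Suc.IH sum_weak_compositions_Suc sum_distrib_right sum_divide_distrib
        power_mult_distrib power_divide)
qed

lemma a_seq_eq: "a_seq N n = (fact n)\<^sup>2 * (bessel_fps ^ N) $ n"
  by (simp add: a_seq_def bessel_power_nth sum_distrib_left power_divide)

section \<open>The series \<open>L\<^sub>m\<close> and their recurrence\<close>

definition bessel_prod :: "nat \<Rightarrow> nat \<Rightarrow> real fps" where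
  "bessel_prod N m =
     fps_const (\<Prod>i<m. real N - real i) * (bessel_fps ^ (N - m) * theta bessel_fps ^ m)"

text \<open>The factor with \<open>i = N\<close> of the constant vanishes.\<close>

lemma bessel_prod_Suc_self: "bessel_prod N (Suc N) = 0"
  by (simp add: bessel_prod_def)

lemma bessel_prod_1: "bessel_prod N 1 = theta (bessel_fps ^ N)"
  by (simp add: bessel_prod_def theta_power fps_of_nat algebra_simps)

text \<open>By the product rule, differentiating the power of y gives
  \<open>bessel_prod N (m + 2)\<close>; differentiating the power of \<open>theta\<close> y gives
  the other term, as \<open>theta\<close> (\<open>theta\<close> y) = x y.\<close>

lemma theta_bessel_prod_Suc:
  assumes "m < N"
  shows "theta (bessel_prod N (Suc m)) = bessel_prod N (m + 2) +
    fps_const (real (m + 1) * (real N - real m)) * (fps_X * bessel_prod N m)"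
proof -
  define d where "d = N - Suc m"
  have N: "N = Suc m + d" using assms by (simp add: d_def)
  define P where "P = (\<Prod>i<m. real N - real i)"
  let ?y = bessel_fps
  \<comment> \<open>For \<open>d = 0\<close> the exponent \<open>d - 1\<close> truncates, but the
    factor \<open>real d\<close> makes both sides zero.\<close>
  have e1: "theta (?y ^ d) = fps_const (real d) * (?y ^ (d - 1) * theta ?y)"
    by (simp add: theta_power fps_of_nat algebra_simps)
  have e2: "theta (theta ?y ^ Suc m) = fps_const (real (m + 1)) * (theta ?y ^ m * (fps_X * ?y))"
    by (simp only: theta_power theta_theta_bessel fps_of_nat diff_Suc_1 mult.assoc
        Suc_eq_plus1[symmetric])
  have d: "N - m = Suc d" "N - (m + 2) = d - 1" "real N - real m = real d + 1"
    "real N - real (Suc m) = real d"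
    unfolding N by simp_all
  have P2: "(\<Prod>i<m + 2. real N - real i) = P * (real d + 1) * real d"
    by (simp add: P_def d del: of_nat_Suc)
  have P1: "(\<Prod>i<Suc m. real N - real i) = P * (real d + 1)"
    by (simp add: P_def d del: of_nat_Suc)
  show ?thesis
    unfolding bessel_prod_def theta_const_mult
    unfolding theta_mult e1 e2 P1 P2 d P_def[symmetric] d_def[symmetric] fps_const_mult[symmetric]
    by (simp only: distrib_left power_Suc add_2_eq_Suc' mult_ac add_ac)
qed

section \<open>Sequences with gaps of at least two\<close>

lemma alpha_seqs_0: "alpha_seqs 0 M = {\<lambda>_. undefined}"
  by (auto simp: alpha_seqs_def)

lemma alpha_seqs_empty_0: "alpha_seqs (Suc k) 0 = {}"
  by (force simp: alpha_seqs_def PiE_iff)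

text \<open>Each step lowers the entry by at least 2 and the last entry is positive, so a sequence
  of length k \<ge> 1 needs 2k - 1 \<le> N.\<close>

lemma alpha_seqs_empty:
  assumes "k > (N + 1) div 2"
  shows "alpha_seqs k N = {}"
proof (rule equals0I)
  fix \<alpha> assume \<alpha>: "\<alpha> \<in> alpha_seqs k N"
  have "1 \<le> i \<Longrightarrow> i \<le> k \<Longrightarrow> \<alpha> i + 2 * (i - 1) \<le> N" for i
  proof (induction i rule: dec_induct)
    case base
    then show ?case using \<alpha> by (auto simp: alpha_seqs_def)
  next
    case (step j)
    then have "\<alpha> (Suc j) + 2 \<le> \<alpha> j" using \<alpha> by (simp add: alpha_seqs_def)
    with step show ?case by simp
  qed
  from this[of k] have "\<alpha> k + 2 * (k - 1) \<le> N" using assms by simp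
  moreover have "\<alpha> k \<ge> 1" using \<alpha> assms by (auto simp: alpha_seqs_def PiE_iff)
  ultimately show False using assms by linarith
qed

definition alpha_cons :: "nat \<Rightarrow> nat \<Rightarrow> (nat \<Rightarrow> nat) \<Rightarrow> nat \<Rightarrow> nat" where
  "alpha_cons k a \<alpha> = (\<lambda>i\<in>{1..Suc k}. if i = 1 then a else \<alpha> (i - 1))"

text \<open>Either the first entry is at most \<open>M\<close>, or it equals \<open>Suc M\<close>
  and the tail starts at \<open>M - 1\<close> or below. For \<open>M = 0\<close> the truncated bound
  still admits only an empty tail.\<close>

lemma sum_alpha_seqs_Suc:
  fixes f :: "(nat \<Rightarrow> nat) \<Rightarrow> real"
  shows "(\<Sum>\<alpha>\<in>alpha_seqs (Suc k) (Suc M). f \<alpha>) =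
    (\<Sum>\<alpha>\<in>alpha_seqs (Suc k) M. f \<alpha>) + (\<Sum>\<alpha>\<in>alpha_seqs k (M - 1). f (alpha_cons k (Suc M) \<alpha>))"
proof -
  let ?B = "{\<alpha> \<in> alpha_seqs (Suc k) (Suc M). \<alpha> 1 = Suc M}"
  have "sum f (alpha_seqs (Suc k) (Suc M)) = sum f (alpha_seqs (Suc k) M \<union> ?B)"
    by (rule arg_cong[of _ _ "sum f"]) (auto simp: alpha_seqs_def)
  also have "\<dots> = sum f (alpha_seqs (Suc k) M) + sum f ?B"
    by (rule sum.union_disjoint) (auto simp: finite_alpha_seqs, auto simp: alpha_seqs_def)
  finally have "sum f (alpha_seqs (Suc k) (Suc M)) = sum f (alpha_seqs (Suc k) M) + sum f ?B" .
  moreover have "sum f ?B = (\<Sum>\<alpha>\<in>alpha_seqs k (M - 1). f (alpha_cons k (Suc M) \<alpha>))"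
  proof (rule sum.reindex_bij_witness
      [where i = "alpha_cons k (Suc M)" and j = "\<lambda>\<alpha>. \<lambda>i\<in>{1..k}. \<alpha> (Suc i)"])
    fix \<alpha> assume \<alpha>: "\<alpha> \<in> ?B"
    then have gap: "\<alpha> (Suc i) + 2 \<le> \<alpha> i" if "1 \<le> i" "i \<le> k" for i
      using that by (auto simp: alpha_seqs_def)
    have "1 \<le> k \<Longrightarrow> \<alpha> 2 \<le> M - 1"
      using gap[of 1] \<alpha> by (simp add: numeral_2_eq_2)
    then show "(\<lambda>i\<in>{1..k}. \<alpha> (Suc i)) \<in> alpha_seqs k (M - 1)"
      using gap \<alpha> by (auto simp: alpha_seqs_def PiE_iff numeral_2_eq_2)
    show eq: "alpha_cons k (Suc M) (\<lambda>i\<in>{1..k}. \<alpha> (Suc i)) = \<alpha>"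
      using \<alpha> by (auto simp: alpha_cons_def fun_eq_iff alpha_seqs_def PiE_iff extensional_def)
    show "f (alpha_cons k (Suc M) (\<lambda>i\<in>{1..k}. \<alpha> (Suc i))) = f \<alpha>"
      by (simp only: eq)
  next
    fix \<alpha> assume \<alpha>: "\<alpha> \<in> alpha_seqs k (M - 1)"
    \<comment> \<open>The lower bound forces M \<ge> 2, so \<open>M - 1\<close> does not truncate
      and the gap below \<open>Suc M\<close> is genuine.\<close>
    have first: "k \<ge> 1 \<Longrightarrow> \<alpha> 1 \<le> M - 1 \<and> 1 \<le> \<alpha> 1"
      using \<alpha> by (auto simp: alpha_seqs_def PiE_iff)
    have gap: "\<alpha> i + 2 \<le> \<alpha> (i - 1)" if "1 < i" "i \<le> k" for i
    proof -
      have "1 \<le> i - 1 \<and> i - 1 < k" using that by auto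
      then have "\<alpha> (i - 1 + 1) + 2 \<le> \<alpha> (i - 1)"
        using \<alpha> unfolding alpha_seqs_def by blast
      then show ?thesis using that by simp
    qed
    have pos: "Suc 0 \<le> \<alpha> (i - Suc 0)" if "1 < i" "i \<le> Suc k" for i
    proof -
      have "i - Suc 0 \<in> {1..k}" using that by auto
      then show ?thesis using \<alpha> by (auto simp: alpha_seqs_def PiE_iff)
    qed
    have "alpha_cons k (Suc M) \<alpha> (i + 1) + 2 \<le> alpha_cons k (Suc M) \<alpha> i"
      if "1 \<le> i" "i < Suc k" for i
      using that first gap[of i] by (cases "i = 1") (auto simp: alpha_cons_def)
    moreover have "alpha_cons k (Suc M) \<alpha> \<in> {1..Suc k} \<rightarrow>\<^sub>E {1..}"
      using pos by (auto simp: alpha_cons_def)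
    ultimately show "alpha_cons k (Suc M) \<alpha> \<in> ?B"
      by (auto simp: alpha_seqs_def) (auto simp: alpha_cons_def)
    show "(\<lambda>i\<in>{1..k}. alpha_cons k (Suc M) \<alpha> (Suc i)) = \<alpha>"
      using \<alpha> by (auto simp: alpha_cons_def fun_eq_iff alpha_seqs_def PiE_iff extensional_def)
  qed
  ultimately show ?thesis by simp
qed

section \<open>The recurrence carried over to coefficients\<close>

definition alpha_factor :: "nat \<Rightarrow> nat \<Rightarrow> nat \<Rightarrow> nat \<Rightarrow> real" where
  "alpha_factor N n i a = - (real a * (real N + 1 - real a) *
     ((real n - real i) / (real n - real i + 1)) ^ (a - 1))"

text \<open>A factor depends on \<open>n\<close> and \<open>i\<close> only through their difference,
  so shifting the tail by one position replaces \<open>n\<close> by \<open>n - 1\<close>.\<close>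

lemma prod_alpha_cons:
  assumes "n \<ge> 1"
  shows "(\<Prod>i=1..Suc k. alpha_factor N n i (alpha_cons k a \<alpha> i)) =
    alpha_factor N n 1 a * (\<Prod>i=1..k. alpha_factor N (n - 1) i (\<alpha> i))"
proof -
  have "(\<Prod>i=1..Suc k. alpha_factor N n i (alpha_cons k a \<alpha> i)) =
    alpha_factor N n 1 (alpha_cons k a \<alpha> 1) *
    (\<Prod>i=1..k. alpha_factor N n (Suc i) (alpha_cons k a \<alpha> (Suc i)))"
    using prod.atLeast_Suc_atMost[of 1 "Suc k" "\<lambda>i. alpha_factor N n i (alpha_cons k a \<alpha> i)"]
    by (simp only: prod.shift_bounds_cl_Suc_ivl One_nat_def Suc_le_mono)
  moreover have "alpha_factor N n (Suc i) (alpha_cons k a \<alpha> (Suc i)) = alpha_factor N (n - 1) i (\<alpha> i)"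
    if "i \<in> {1..k}" for i
    using that assms by (auto simp: alpha_factor_def alpha_cons_def of_nat_diff algebra_simps)
  ultimately show ?thesis by (simp add: alpha_cons_def)
qed

text \<open>
  The coefficient of \<open>a\<^sub>n\<^sub>-\<^sub>k\<close> in \<open>n!\<^sup>2\<close> times the \<open>n\<close>-th coefficient of \<open>L\<^sub>m\<close>. For \<open>m = 0\<close> the bound
  \<open>m - 1\<close> truncates harmlessly, since \<open>alpha_seqs k 0\<close> contains at most the empty sequence.
\<close>

definition c_gen :: "nat \<Rightarrow> nat \<Rightarrow> nat \<Rightarrow> nat \<Rightarrow> real" where
  "c_gen N m k n =
     real n ^ m * (\<Sum>\<alpha>\<in>alpha_seqs k (m - 1). \<Prod>i=1..k. alpha_factor N n i (\<alpha> i))"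

lemma c_gen_0: "c_gen N m 0 n = real n ^ m"
  by (simp add: c_gen_def alpha_seqs_0)

lemma c_gen_Suc_0: "m \<le> 1 \<Longrightarrow> c_gen N m (Suc k) n = 0"
  by (simp add: c_gen_def alpha_seqs_empty_0)

text \<open>Split by whether the first entry takes its maximal value \<open>m + 1\<close>. If so,
  its factor turns \<open>n ^ (m + 2)\<close> into \<open>n ^ 2 * (n - 1) ^ m\<close>, whose last
  power is the prefactor of \<open>c_gen\<close> at \<open>n - 1\<close>.\<close>

lemma c_gen_Suc:
  assumes "n \<ge> 1"
  shows "c_gen N (m + 2) (Suc k) n = real n * c_gen N (Suc m) (Suc k) n -
    real (m + 1) * (real N - real m) * (real n)\<^sup>2 * c_gen N m k (n - 1)"
proof -
  have "real n ^ (m + 2) * alpha_factor N n 1 (Suc m) =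
    - (real (m + 1) * (real N - real m) * (real n)\<^sup>2 * real (n - 1) ^ m)"
    using assms
    by (simp add: alpha_factor_def power_divide power_add power2_eq_square)
  then have "real n ^ (m + 2) * (alpha_factor N n 1 (Suc m) * S) =
    - (real (m + 1) * (real N - real m) * (real n)\<^sup>2 * (real (n - 1) ^ m * S))" for S
    by (metis (no_types, opaque_lifting) mult.assoc mult_minus_left)
  moreover have "c_gen N (m + 2) (Suc k) n = real n * c_gen N (Suc m) (Suc k) n +
    real n ^ (m + 2) * (alpha_factor N n 1 (Suc m) *
      (\<Sum>\<alpha>\<in>alpha_seqs k (m - 1). \<Prod>i=1..k. alpha_factor N (n - 1) i (\<alpha> i)))"
    unfolding c_gen_def sum_distrib_left[of "alpha_factor N n 1 (Suc m)"]
      prod_alpha_cons[OF assms, symmetric]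
    by (simp add: sum_alpha_seqs_Suc distrib_left del: prod.cl_ivl_Suc)
  ultimately show ?thesis
    by (simp add: c_gen_def)
qed

text \<open>Both sides obey the same recurrence in \<open>m\<close>: \<open>theta\<close> multiplies
  the n-th coefficient by n, and the factor x shifts to n - 1, where \<open>fact n\<close>
  contributes n squared.\<close>

lemma bessel_prod_nth:
  "m \<le> Suc N \<Longrightarrow>
    (fact n)\<^sup>2 * bessel_prod N m $ n = (\<Sum>k=0..n. c_gen N m k n * a_seq N (n - k))"
proof (induction m arbitrary: n rule: induct_nat_012)
  case 0
  show ?case
    by (subst sum.atLeast_Suc_atMost)
      (auto simp: c_gen_0 a_seq_eq bessel_prod_def intro!: sum.neutral
        dest!: Suc_le_D simp: c_gen_Suc_0)
next
  case 1
  have "bessel_prod N 1 $ n = real n * (bessel_fps ^ N) $ n"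
    by (simp only: bessel_prod_1 theta_nth)
  then show ?case
    by (subst sum.atLeast_Suc_atMost)
      (auto simp: c_gen_0 a_seq_eq intro!: sum.neutral dest!: Suc_le_D simp: c_gen_Suc_0)
next
  case (ge2 m)
  define K where "K = real (m + 1) * (real N - real m)"
  have "m < N" using ge2.prems by simp
  from theta_bessel_prod_Suc[OF this]
  have rec: "bessel_prod N (m + 2) =
    theta (bessel_prod N (Suc m)) - fps_const K * (fps_X * bessel_prod N m)"
    by (simp add: K_def)
  show ?case
  proof (cases n)
    case 0
    then show ?thesis using rec by (simp add: theta_nth c_gen_0)
  next
    case (Suc l)
    let ?a = "\<lambda>k. a_seq N (l - k)"
    have IH1: "(fact n)\<^sup>2 * bessel_prod N (Suc m) $ n =
      real n ^ Suc m * a_seq N n + (\<Sum>k=0..l. c_gen N (Suc m) (Suc k) n * ?a k)"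
      \<comment> \<open>The term k = 0 is split off, so that the remaining indices
        \<open>Suc k\<close> fit \<open>c_gen_Suc\<close>.\<close>
      using ge2.IH(2)[of n] ge2.prems Suc
      by (simp add: sum.atLeast0_atMost_Suc_shift c_gen_0 del: sum.cl_ivl_Suc)
    have IH2: "(fact l)\<^sup>2 * bessel_prod N m $ l = (\<Sum>k=0..l. c_gen N m k l * ?a k)"
      using ge2.IH(1)[of l] ge2.prems by simp
    have "(fact n)\<^sup>2 * bessel_prod N (m + 2) $ n =
      real n * ((fact n)\<^sup>2 * bessel_prod N (Suc m) $ n) -
      K * (real n)\<^sup>2 * ((fact l)\<^sup>2 * bessel_prod N m $ l)"
      unfolding rec by (simp add: theta_nth Suc power2_eq_square algebra_simps)
    also have "\<dots> = real n ^ (m + 2) * a_seq N n +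
      (real n * (\<Sum>k=0..l. c_gen N (Suc m) (Suc k) n * ?a k) -
       K * (real n)\<^sup>2 * (\<Sum>k=0..l. c_gen N m k l * ?a k))"
      unfolding IH1 IH2 by (simp add: algebra_simps)
    also have "real n * (\<Sum>k=0..l. c_gen N (Suc m) (Suc k) n * ?a k) -
       K * (real n)\<^sup>2 * (\<Sum>k=0..l. c_gen N m k l * ?a k) =
      (\<Sum>k=0..l. c_gen N (m + 2) (Suc k) n * ?a k)"
    proof -
      have "c_gen N (m + 2) (Suc k) n =
        real n * c_gen N (Suc m) (Suc k) n - K * (real n)\<^sup>2 * c_gen N m k l" for k
        using c_gen_Suc[of n N m k] by (simp add: Suc K_def)
      then show ?thesis
        by (simp only: sum_distrib_left sum_subtractf[symmetric] left_diff_distrib mult.assoc)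
    qed
    also have "real n ^ (m + 2) * a_seq N n + (\<Sum>k=0..l. c_gen N (m + 2) (Suc k) n * ?a k) =
      (\<Sum>k=0..n. c_gen N (m + 2) k n * a_seq N (n - k))"
      by (simp add: Suc sum.atLeast0_atMost_Suc_shift c_gen_0 del: sum.cl_ivl_Suc)
    finally show ?thesis by simp
  qed
qed

theorem theorem1:
  fixes N n :: nat
  assumes "N \<ge> 1"
    and "n \<ge> max 1 ((N + 1) div 2)"
  shows "(\<Sum>k=0..(N + 1) div 2. c_coeff N k n * a_seq N (n - k)) = 0"
proof -
  have c: "c_coeff N k n = c_gen N (Suc N) k n" for k
    by (simp add: c_coeff_def c_gen_def alpha_factor_def)
  \<comment> \<open>The lower bound on \<open>n\<close> makes this an extension of the range; the
    added terms vanish by \<open>alpha_seqs_empty\<close>.\<close>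
  have "(\<Sum>k=0..(N + 1) div 2. c_coeff N k n * a_seq N (n - k)) =
    (\<Sum>k=0..n. c_coeff N k n * a_seq N (n - k))"
    using assms by (intro sum.mono_neutral_left) (auto simp: c_coeff_def alpha_seqs_empty)
  also have "\<dots> = (fact n)\<^sup>2 * bessel_prod N (Suc N) $ n"
    by (simp add: c bessel_prod_nth)
  finally show ?thesis
    by (simp add: bessel_prod_Suc_self)
qed

end
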